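(* Let $a>0$, let $\alpha(t)=(0,\sinh t,\cosh t)$, $t\in\mathbb{R}$ (a spacelike circle of $\mathbb{L}^3$ with spacelike axis), and let $$V(t)=\cosh(at)\,\mathbf{n}(t)+\sinh(at)\,\mathbf{b}(t)=(\sinh(at),\,\cosh(at)\sinh t,\,\cosh(at)\cosh t),$$ where $\mathbf{n}(t)=(0,\sinh t,\cosh t)$ and $\mathbf{b}(t)=(1,0,0)$. Then the Björling surface $X=(X_1,X_2,X_3)$ with data $\alpha$ and $V$ is parametrized as follows. If $a\neq1$: $$X_1=\frac{\cosh(au)\sin(av)}{a},$$ $$X_2=\sinh u\cos v+\frac{1}{a^2-1}\Big(-\sin v\cos(av)\sinh u\sinh(au)+a\sin(av)\cos v\sinh u\sinh(au)+a\sin v\cos(av)\cosh u\cosh(au)-\cos v\sin(av)\cosh u\cosh(au)\Big),$$ $$X_3=\cosh u\cos v+\frac{1}{a^2-1}\Big(a\cos v\sin(av)\cosh u\sinh(au)-\sin v\cos(av)\cosh u\sinh(au)+a\sin v\cos(av)\sinh u\cosh(au)-\cos v\sin(av)\sinh u\cosh(au)\Big).$$ If $a=1$: $$X_1=\cosh u\sin v,\qquad X_2=\sinh u\cos v+\tfrac12\sin v\cos v\,(\sinh^2u+\cosh^2u)-\tfrac v2,\qquad X_3=\cosh u\cos v\,(1+\sinh u\sin v).$$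
   Context: $\mathbb{L}^3$ is $\mathbb{R}^3$ with the metric $\langle,\rangle=dx^2+dy^2-dz^2$. The Lorentzian cross product is $(x_1,x_2,x_3)\times(y_1,y_2,y_3)=(x_2y_3-x_3y_2,\ x_3y_1-x_1y_3,\ -(x_1y_2-x_2y_1))$, extended complex-bilinearly. A maximal surface is a spacelike surface (induced metric Riemannian) with zero mean curvature everywhere. Björling problem: given a real analytic spacelike curve $\alpha:I\to\mathbb{L}^3$ and a real analytic unit timelike vector field $V$ along $\alpha$ with $\langle V,\alpha'\rangle=0$, find a maximal surface containing $\alpha$ with unit normal $V$ along $\alpha$. Its solution (the Björling surface with data $\alpha,V$, unique with $\alpha$ being the parameter curve $v=0$) is $$X(u,v)=\mathrm{Re}\left(\alpha(z)+i\int_{u_0}^z V(w)\times\alpha'(w)\,dw\right),\qquad z=u+iv,$$ where $u_0\in I$ is fixed (here $u_0=0$) and $\alpha(z),V(z)$ are the holomorphic extensions of $\alpha,V$ to a simply-connected domain of $\mathbb{C}$ containing $I\times\{0\}$. Maximality is understood away from points where $X$ fails to be an immersion with nondegenerate induced metric. *)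

theory Defs
  imports "HOL-Complex_Analysis.Complex_Analysis"
begin

section \<open>Lorentz-Minkowski space\<close>

definition lorentz_inner :: "real^3 \<Rightarrow> real^3 \<Rightarrow> real" where
  "lorentz_inner x y = x$1 * y$1 + x$2 * y$2 - x$3 * y$3"

text \<open>Polymorphic, so that the instance at \<^typ>\<open>complex\<close> is the complex-bilinear extension of
  the instance at \<^typ>\<open>real\<close>.\<close>

definition lorentz_cross :: "'a::comm_ring_1^3 \<Rightarrow> 'a^3 \<Rightarrow> 'a^3" where
  "lorentz_cross x y = vector
     [x$2 * y$3 - x$3 * y$2, x$3 * y$1 - x$1 * y$3, - (x$1 * y$2 - x$2 * y$1)]"


section \<open>Maximal surfaces\<close>

text \<open>Parametrized surfaces are maps \<open>X u v\<close>, considered for \<open>Complex u v \<in> D\<close> with \<open>D\<close> open;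
  values of \<open>X\<close> off \<open>D\<close> are irrelevant.\<close>

definition du :: "(real \<Rightarrow> real \<Rightarrow> real^3) \<Rightarrow> real \<Rightarrow> real \<Rightarrow> real^3" where
  "du X u v = vector_derivative (\<lambda>s. X s v) (at u)"

definition dv :: "(real \<Rightarrow> real \<Rightarrow> real^3) \<Rightarrow> real \<Rightarrow> real \<Rightarrow> real^3" where
  "dv X u v = vector_derivative (\<lambda>s. X u s) (at v)"

definition C1_on :: "complex set \<Rightarrow> (real \<Rightarrow> real \<Rightarrow> real^3) \<Rightarrow> bool" where
  "C1_on D X \<longleftrightarrow>
     (\<forall>u v. Complex u v \<in> D \<longrightarrow>
        (\<lambda>s. X s v) differentiable (at u) \<and> (\<lambda>s. X u s) differentiable (at v)) \<and>
     continuous_on D (\<lambda>z. du X (Re z) (Im z)) \<and>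
     continuous_on D (\<lambda>z. dv X (Re z) (Im z))"

definition C2_on :: "complex set \<Rightarrow> (real \<Rightarrow> real \<Rightarrow> real^3) \<Rightarrow> bool" where
  "C2_on D X \<longleftrightarrow> C1_on D X \<and> C1_on D (du X) \<and> C1_on D (dv X)"

definition fundE :: "(real \<Rightarrow> real \<Rightarrow> real^3) \<Rightarrow> real \<Rightarrow> real \<Rightarrow> real" where
  "fundE X u v = lorentz_inner (du X u v) (du X u v)"

definition fundF :: "(real \<Rightarrow> real \<Rightarrow> real^3) \<Rightarrow> real \<Rightarrow> real \<Rightarrow> real" where
  "fundF X u v = lorentz_inner (du X u v) (dv X u v)"

definition fundG :: "(real \<Rightarrow> real \<Rightarrow> real^3) \<Rightarrow> real \<Rightarrow> real \<Rightarrow> real" where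
  "fundG X u v = lorentz_inner (dv X u v) (dv X u v)"

definition metric_det :: "(real \<Rightarrow> real \<Rightarrow> real^3) \<Rightarrow> real \<Rightarrow> real \<Rightarrow> real" where
  "metric_det X u v = fundE X u v * fundG X u v - (fundF X u v)^2"

text \<open>Since \<open>metric_det\<close> vanishes if \<open>du X\<close> and \<open>dv X\<close> are linearly dependent, this
  includes that \<open>X\<close> is an immersion at the point.\<close>

definition regular_at :: "(real \<Rightarrow> real \<Rightarrow> real^3) \<Rightarrow> real \<Rightarrow> real \<Rightarrow> bool" where
  "regular_at X u v \<longleftrightarrow> metric_det X u v \<noteq> 0"

definition spacelike_at :: "(real \<Rightarrow> real \<Rightarrow> real^3) \<Rightarrow> real \<Rightarrow> real \<Rightarrow> bool" where
  "spacelike_at X u v \<longleftrightarrow>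
     (\<forall>p q. (p, q) \<noteq> (0, 0) \<longrightarrow>
        lorentz_inner (p *\<^sub>R du X u v + q *\<^sub>R dv X u v) (p *\<^sub>R du X u v + q *\<^sub>R dv X u v) > 0)"

definition unit_normal :: "(real \<Rightarrow> real \<Rightarrow> real^3) \<Rightarrow> real \<Rightarrow> real \<Rightarrow> real^3" where
  "unit_normal X u v = (let w = lorentz_cross (du X u v) (dv X u v) in
     (1 / sqrt \<bar>lorentz_inner w w\<bar>) *\<^sub>R w)"

text \<open>The factor -1 coming from the timelike normal is omitted, as only the vanishing of the mean
  curvature is used.\<close>

definition mean_curvature :: "(real \<Rightarrow> real \<Rightarrow> real^3) \<Rightarrow> real \<Rightarrow> real \<Rightarrow> real" where
  "mean_curvature X u v =
     (let n = unit_normal X u v;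
          e = lorentz_inner (du (du X) u v) n;
          f = lorentz_inner (dv (du X) u v) n;
          g = lorentz_inner (dv (dv X) u v) n
      in (fundE X u v * g - 2 * fundF X u v * f + fundG X u v * e) / (2 * metric_det X u v))"

definition maximal_surface :: "complex set \<Rightarrow> (real \<Rightarrow> real \<Rightarrow> real^3) \<Rightarrow> bool" where
  "maximal_surface D X \<longleftrightarrow> C2_on D X \<and>
     (\<forall>u v. Complex u v \<in> D \<and> regular_at X u v \<longrightarrow> spacelike_at X u v \<and> mean_curvature X u v = 0)"


section \<open>The Bjorling problem\<close>

definition real_analytic_on :: "(real \<Rightarrow> real^3) \<Rightarrow> real set \<Rightarrow> bool" where
  "real_analytic_on f I \<longleftrightarrow>
     (\<forall>t0\<in>I. \<exists>r>0. \<exists>c :: nat \<Rightarrow> real^3. \<forall>t. \<bar>t - t0\<bar> < r \<longrightarrow> (\<lambda>n. (t - t0)^n *\<^sub>R c n) sums f t)"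

definition bjorling_data :: "real set \<Rightarrow> (real \<Rightarrow> real^3) \<Rightarrow> (real \<Rightarrow> real^3) \<Rightarrow> bool" where
  "bjorling_data I \<alpha> V \<longleftrightarrow>
     is_interval I \<and> open I \<and> I \<noteq> {} \<and> real_analytic_on \<alpha> I \<and> real_analytic_on V I \<and>
     (\<forall>t\<in>I. let \<alpha>' = vector_derivative \<alpha> (at t) in
        lorentz_inner \<alpha>' \<alpha>' > 0 \<and> lorentz_inner (V t) (V t) = -1 \<and> lorentz_inner (V t) \<alpha>' = 0)"

definition bjorling_domain :: "real set \<Rightarrow> complex set \<Rightarrow> bool" where
  "bjorling_domain I D \<longleftrightarrow> open D \<and> simply_connected D \<and> complex_of_real ` I \<subseteq> D"

definition solves_bjorling_problem ::
  "real set \<Rightarrow> (real \<Rightarrow> real^3) \<Rightarrow> (real \<Rightarrow> real^3) \<Rightarrow> complex set \<Rightarrow> (real \<Rightarrow> real \<Rightarrow> real^3) \<Rightarrow> bool" where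
  "solves_bjorling_problem I \<alpha> V D X \<longleftrightarrow> maximal_surface D X \<and>
     (\<forall>u\<in>I. regular_at X u 0 \<and> X u 0 = \<alpha> u \<and> unit_normal X u 0 = V u)"

definition holomorphic_extension ::
  "real set \<Rightarrow> complex set \<Rightarrow> (real \<Rightarrow> real^3) \<Rightarrow> (complex \<Rightarrow> complex^3) \<Rightarrow> bool" where
  "holomorphic_extension I D f F \<longleftrightarrow>
     (\<forall>k. (\<lambda>z. F z $ k) holomorphic_on D) \<and>
     (\<forall>t\<in>I. \<forall>k. F (of_real t) $ k = of_real (f t $ k))"

definition cderiv :: "(complex \<Rightarrow> complex^3) \<Rightarrow> complex \<Rightarrow> complex^3" where
  "cderiv F z = (\<chi> k. deriv (\<lambda>w. F w $ k) z)"

definition path_integral :: "(real \<Rightarrow> complex) \<Rightarrow> (complex \<Rightarrow> complex^3) \<Rightarrow> complex^3" where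
  "path_integral \<gamma> F = (\<chi> k. contour_integral \<gamma> (\<lambda>w. F w $ k))"

definition Re_vec :: "complex^3 \<Rightarrow> real^3" where
  "Re_vec x = (\<chi> k. Re (x $ k))"

text \<open>The integral from \<open>u\<^sub>0\<close> to \<open>z\<close> is taken along an arbitrary path in \<open>D\<close>; it does not
  depend on the path when \<open>D\<close> is simply connected.\<close>

definition bjorling_representation ::
  "real set \<Rightarrow> (real \<Rightarrow> real^3) \<Rightarrow> (real \<Rightarrow> real^3) \<Rightarrow> real \<Rightarrow> complex set \<Rightarrow> (real \<Rightarrow> real \<Rightarrow> real^3) \<Rightarrow> bool" where
  "bjorling_representation I \<alpha> V u\<^sub>0 D X \<longleftrightarrow>
     (\<exists>A W. holomorphic_extension I D \<alpha> A \<and> holomorphic_extension I D V W \<and>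
       (\<forall>u v \<gamma>. Complex u v \<in> D \<and> valid_path \<gamma> \<and> path_image \<gamma> \<subseteq> D \<and>
                pathstart \<gamma> = of_real u\<^sub>0 \<and> pathfinish \<gamma> = Complex u v \<longrightarrow>
          X u v = Re_vec (A (Complex u v) +
                          \<i> *s path_integral \<gamma> (\<lambda>w. lorentz_cross (W w) (cderiv A w)))))"

definition bjorling_surface ::
  "real set \<Rightarrow> (real \<Rightarrow> real^3) \<Rightarrow> (real \<Rightarrow> real^3) \<Rightarrow> real \<Rightarrow> complex set \<Rightarrow> (real \<Rightarrow> real \<Rightarrow> real^3) \<Rightarrow> bool" where
  "bjorling_surface I \<alpha> V u\<^sub>0 D X \<longleftrightarrow>
     bjorling_data I \<alpha> V \<and> bjorling_domain I D \<and> u\<^sub>0 \<in> I \<and>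
     solves_bjorling_problem I \<alpha> V D X \<and> bjorling_representation I \<alpha> V u\<^sub>0 D X"


section \<open>The circle with spacelike axis and its normal fields\<close>

definition circ :: "real \<Rightarrow> real^3" where
  "circ t = vector [0, sinh t, cosh t]"

definition circ_n :: "real \<Rightarrow> real^3" where
  "circ_n t = vector [0, sinh t, cosh t]"

definition circ_b :: "real \<Rightarrow> real^3" where
  "circ_b t = vector [1, 0, 0]"

definition circ_field :: "real \<Rightarrow> real \<Rightarrow> real^3" where
  "circ_field a t = cosh (a * t) *\<^sub>R circ_n t + sinh (a * t) *\<^sub>R circ_b t"

lemma circ_field_eq:
  "circ_field a t = vector [sinh (a * t), cosh (a * t) * sinh t, cosh (a * t) * cosh t]"
  by (simp add: circ_field_def circ_n_def circ_b_def vec_eq_iff forall_3 vector_3)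

end

(* A real map is a conformal harmonic parametrization, hence maximal, as soon as it is the real part
   of a holomorphic curve whose velocity is isotropic for the complex-bilinear Lorentz product. Here
   the curve is Phi = A + i P, where A(z) = (0, sinh z, cosh z) extends the circle and P is an
   explicit primitive of V x A' with P(0) real. Holomorphic extensions are unique on the connected
   domain D and the path integral of V x A' is a difference of values of P, so the representation
   formula says exactly that X = Re Phi; splitting sinh and cosh of u + iv into real and imaginary
   parts then gives the coordinates. *)

theory Submission
  imports Defs
begin

unbundle no Formal_Power_Series.fps_syntax

section \<open>Real parts of holomorphic curves\<close>

lemma Re_vec_nth [simp]: "Re_vec x $ k = Re (x $ k)"
  by (simp add: Re_vec_def)

lemma cderiv_nth [simp]: "cderiv F z $ k = deriv (\<lambda>w. F w $ k) z"
  by (simp add: cderiv_def)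

lemma has_vector_derivative_vecI:
  fixes f :: "real \<Rightarrow> real^'n"
  assumes "\<And>k. ((\<lambda>s. f s $ k) has_real_derivative D $ k) (at t)"
  shows "(f has_vector_derivative D) (at t)"
  unfolding has_vector_derivative_def has_derivative_componentwise_within[of f]
  using assms
  by (auto simp: Basis_vec_def inner_axis has_field_derivative_def mult.commute[of _ "D $ _"])

text \<open>Chain rule: \<open>Complex u v\<close> moves with velocity 1 in \<open>u\<close> and
  \<open>\<i>\<close> in \<open>v\<close>, and taking real parts commutes with real
  differentiation.\<close>

lemma
  assumes "open D"
    and hol: "\<And>k. (\<lambda>z. F z $ k) holomorphic_on D"
    and X: "\<And>u v. Complex u v \<in> D \<Longrightarrow> X u v = Re_vec (F (Complex u v))"
    and z: "Complex u v \<in> D"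
  shows has_vector_derivative_Re_vec_u:
      "((\<lambda>s. X s v) has_vector_derivative Re_vec (cderiv F (Complex u v))) (at u)"
    and has_vector_derivative_Re_vec_v:
      "((\<lambda>s. X u s) has_vector_derivative Re_vec (\<i> *s cderiv F (Complex u v))) (at v)"
proof -
  have der: "((\<lambda>z. F z $ k) has_field_derivative cderiv F (Complex u v) $ k) (at (Complex u v))" for k
    using holomorphic_derivI[OF hol \<open>open D\<close> z] by simp
  have cu: "((\<lambda>s. Complex s v) has_vector_derivative 1) (at u)"
    by (auto intro!: derivative_eq_intros simp: Complex_eq)
  have cv: "((\<lambda>s. Complex u s) has_vector_derivative \<i>) (at v)"
    unfolding Complex_eq by (auto intro!: derivative_eq_intros)
  have Du: "((\<lambda>s. Re (F (Complex s v) $ k)) has_real_derivative Re (cderiv F (Complex u v) $ k)) (at u)" for k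
    using field_vector_diff_chain_at[OF cu der[of k]]
    by (auto simp: o_def dest: has_field_derivative_Re)
  have Dv: "((\<lambda>s. Re (F (Complex u s) $ k)) has_real_derivative Re (\<i> * cderiv F (Complex u v) $ k)) (at v)" for k
    using field_vector_diff_chain_at[OF cv der[of k]]
    by (auto simp: o_def dest: has_field_derivative_Re)
  \<comment> \<open>\<open>X\<close> is known only on \<open>D\<close>; openness of the two slices
    lets the derivative pass from the real part of \<open>F\<close> to \<open>X\<close>.\<close>
  have "open ((\<lambda>s. Complex s v) -` D)" "open ((\<lambda>s. Complex u s) -` D)"
    unfolding Complex_eq by (auto intro!: open_vimage \<open>open D\<close> continuous_intros)
  note o = this
  show "((\<lambda>s. X s v) has_vector_derivative Re_vec (cderiv F (Complex u v))) (at u)"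
    by (rule has_vector_derivative_transform_within_open[OF _ o(1)])
       (use z X Du in \<open>auto intro!: has_vector_derivative_vecI\<close>)
  show "((\<lambda>s. X u s) has_vector_derivative Re_vec (\<i> *s cderiv F (Complex u v))) (at v)"
    by (rule has_vector_derivative_transform_within_open[OF _ o(2)])
       (use z X Dv in \<open>auto intro!: has_vector_derivative_vecI\<close>)
qed

lemmas du_Re_vec = has_vector_derivative_Re_vec_u[THEN vector_derivative_at, folded du_def]
  and dv_Re_vec = has_vector_derivative_Re_vec_v[THEN vector_derivative_at, folded dv_def]

lemma holomorphic_cderiv:
  assumes "open D" "\<And>k. (\<lambda>z. F z $ k) holomorphic_on D"
  shows "(\<lambda>z. cderiv F z $ k) holomorphic_on D"
  using assms by (auto intro!: holomorphic_intros)

text \<open>Since only agreement on \<open>D\<close> with the real part of a holomorphic curve is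
  assumed, this applies again to \<open>du X\<close> and \<open>dv X\<close>, the real parts of
  \<open>cderiv F\<close> and of \<open>\<i>\<close> times it. Three uses give
  \<open>C2_on\<close>.\<close>

lemma C1_on_Re_vec:
  assumes "open D"
    and hol: "\<And>k. (\<lambda>z. F z $ k) holomorphic_on D"
    and X: "\<And>u v. Complex u v \<in> D \<Longrightarrow> X u v = Re_vec (F (Complex u v))"
  shows "C1_on D X"
  unfolding C1_on_def
proof (intro conjI allI impI)
  fix u v assume z: "Complex u v \<in> D"
  show "(\<lambda>s. X s v) differentiable at u" "(\<lambda>s. X u s) differentiable at v"
    using has_vector_derivative_Re_vec_u[OF assms z] has_vector_derivative_Re_vec_v[OF assms z]
    by (auto simp: has_vector_derivative_def differentiable_def)
next
  have c: "continuous_on D (\<lambda>z. deriv (\<lambda>w. F w $ k) z)" for k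
    using holomorphic_cderiv[OF assms(1,2), of k] by (simp add: holomorphic_on_imp_continuous_on)
  have "continuous_on D (\<lambda>z. Re_vec (cderiv F z))"
    unfolding Re_vec_def by (auto intro!: continuous_intros c)
  then show "continuous_on D (\<lambda>z. du X (Re z) (Im z))"
    by (rule continuous_on_eq) (simp add: du_Re_vec[OF assms])
  have "continuous_on D (\<lambda>z. Re_vec (\<i> *s cderiv F z))"
    unfolding Re_vec_def by (auto intro!: continuous_intros c)
  then show "continuous_on D (\<lambda>z. dv X (Re z) (Im z))"
    by (rule continuous_on_eq) (simp add: dv_Re_vec[OF assms])
qed

section \<open>Isotropic velocity and maximality\<close>

text \<open>Two timelike vectors are never orthogonal: the product of their third coordinates would
  equal the inner product of their planar parts, which Cauchy-Schwarz makes too small. Applied to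
  \<open>du X\<close> and \<open>dv X\<close>, this rules out E < 0.\<close>

lemma orthogonal_same_norm_not_timelike:
  assumes "lorentz_inner x x = lorentz_inner y y" "lorentz_inner x y = 0"
  shows "lorentz_inner x x \<ge> 0"
proof (rule ccontr)
  assume "\<not> ?thesis"
  then have lt: "x$1^2 + x$2^2 < x$3^2" "y$1^2 + y$2^2 < y$3^2"
    using assms(1) by (auto simp: lorentz_inner_def power2_eq_square)
  have "(x$3 * y$3)^2 = (x$1 * y$1 + x$2 * y$2)^2"
    using assms(2) by (simp add: lorentz_inner_def)
  also have "\<dots> \<le> (x$1^2 + x$2^2) * (y$1^2 + y$2^2)"
    \<comment> \<open>Lagrange's identity: this square is the difference of the two sides.\<close>
    using zero_le_power2[of "x$1 * y$2 - x$2 * y$1"]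
    by (simp add: power2_eq_square algebra_simps)
  also have "\<dots> < x$3^2 * y$3^2"
    using lt by (intro mult_strict_mono') auto
  finally show False by (simp add: power_mult_distrib)
qed

text \<open>Isotropy gives \<open>E = G\<close> and \<open>F = 0\<close>, so the mean curvature is a multiple of the normal
  component of the Laplacian of \<open>X\<close>.\<close>

lemma maximal_surface_Re_vec:
  assumes "open D"
    and hol: "\<And>k. (\<lambda>z. F z $ k) holomorphic_on D"
    and X: "\<And>u v. Complex u v \<in> D \<Longrightarrow> X u v = Re_vec (F (Complex u v))"
    and iso: "\<And>z. z \<in> D \<Longrightarrow>
      (cderiv F z $ 1)^2 + (cderiv F z $ 2)^2 - (cderiv F z $ 3)^2 = 0"
  shows "maximal_surface D X"
  unfolding maximal_surface_def C2_on_def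
proof (intro conjI allI impI)
  note hol' = holomorphic_cderiv[OF \<open>open D\<close> hol]
  have hol'': "(\<lambda>z. (\<i> *s cderiv F z) $ k) holomorphic_on D" for k
    using hol'[of k] by (auto intro!: holomorphic_intros)
  note du = du_Re_vec[OF \<open>open D\<close> hol X] and dv = dv_Re_vec[OF \<open>open D\<close> hol X]
  show "C1_on D X" "C1_on D (du X)" "C1_on D (dv X)"
    by (rule C1_on_Re_vec[OF \<open>open D\<close>], (rule hol X hol' du hol'' dv; assumption?)+)+
  fix u v assume uv: "Complex u v \<in> D \<and> regular_at X u v"
  define z where "z = Complex u v"
  have z: "z \<in> D" using uv by (simp add: z_def)
  \<comment> \<open>Writing \<open>cderiv F z\<close> as p + iq, the tangent vectors are p and -q,
    so the real part of the isotropy equation is E = G and the imaginary part is F = 0.\<close>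
  have Re_iso: "(Re (cderiv F z $ 1))^2 - (Im (cderiv F z $ 1))^2
      + ((Re (cderiv F z $ 2))^2 - (Im (cderiv F z $ 2))^2)
      - ((Re (cderiv F z $ 3))^2 - (Im (cderiv F z $ 3))^2) = 0"
    using arg_cong[OF iso[OF z], of Re] by (simp add: power2_eq_square)
  have Im_iso: "Re (cderiv F z $ 1) * Im (cderiv F z $ 1) + Re (cderiv F z $ 2) * Im (cderiv F z $ 2)
      - Re (cderiv F z $ 3) * Im (cderiv F z $ 3) = 0"
    using arg_cong[OF iso[OF z], of Im] by (simp add: power2_eq_square mult.commute)
  have EG: "fundE X u v = fundG X u v"
    using Re_iso uv by (simp add: fundE_def fundG_def lorentz_inner_def du dv z_def power2_eq_square)
  have F0: "fundF X u v = 0"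
    using Im_iso uv by (simp add: fundF_def lorentz_inner_def du dv z_def)
  \<comment> \<open>With E = G and F = 0, \<open>metric_det\<close> is the square of E.\<close>
  have "fundE X u v \<noteq> 0"
    using uv EG F0 by (simp add: regular_at_def metric_det_def)
  moreover have "fundE X u v \<ge> 0"
    using orthogonal_same_norm_not_timelike[of "du X u v" "dv X u v"] EG F0
    by (simp add: fundE_def fundF_def fundG_def)
  ultimately have Epos: "fundE X u v > 0" by simp
  show "spacelike_at X u v"
    unfolding spacelike_at_def
  proof (intro allI impI)
    fix p q :: real assume pq: "(p, q) \<noteq> (0, 0)"
    have "lorentz_inner (p *\<^sub>R du X u v + q *\<^sub>R dv X u v) (p *\<^sub>R du X u v + q *\<^sub>R dv X u v)
        = p^2 * fundE X u v + 2 * p * q * fundF X u v + q^2 * fundG X u v"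
      by (simp add: fundE_def fundF_def fundG_def lorentz_inner_def algebra_simps power2_eq_square)
    also have "\<dots> = (p^2 + q^2) * fundE X u v"
      using EG F0 by (simp add: algebra_simps)
    also have "\<dots> > 0"
      using Epos pq by (intro mult_pos_pos) (auto simp: sum_power2_gt_zero_iff)
    finally show "lorentz_inner (p *\<^sub>R du X u v + q *\<^sub>R dv X u v) (p *\<^sub>R du X u v + q *\<^sub>R dv X u v) > 0" .
  qed
  \<comment> \<open>Each differentiation in \<open>v\<close> contributes a factor
    \<open>\<i>\<close>, and two of them give -1.\<close>
  have harmonic: "dv (dv X) u v = - du (du X) u v"
  proof -
    have "deriv (\<lambda>z. \<i> * deriv (\<lambda>w. F w $ k) z) z = \<i> * deriv (deriv (\<lambda>w. F w $ k)) z" for k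
      using holomorphic_on_imp_differentiable_at[OF hol'[of k] \<open>open D\<close> z]
      by (intro deriv_cmult) simp
    then show ?thesis
      using uv by (simp add: du_Re_vec[OF \<open>open D\<close> hol' du] dv_Re_vec[OF \<open>open D\<close> hol'' dv]
          vec_eq_iff z_def)
  qed
  have "lorentz_inner (- x) y = - lorentz_inner x y" for x y
    by (simp add: lorentz_inner_def)
  then show "mean_curvature X u v = 0"
    using harmonic EG F0 by (simp add: mean_curvature_def Let_def)
qed

section \<open>Holomorphic extensions of real curves\<close>

text \<open>The Taylor series of the entire extension at a real point has real powers along the real
  line, so the real parts of its coefficients give a real power series for \<open>f\<close>.\<close>

lemma holomorphic_extension_imp_real_analytic:
  assumes "holomorphic_extension UNIV UNIV f F"
  shows "real_analytic_on f UNIV"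
  unfolding real_analytic_on_def
proof
  fix t0 :: real
  define b where "b k n = (deriv ^^ n) (\<lambda>z. F z $ k) (of_real t0) / fact n" for k n
  have "(\<lambda>n. (t - t0)^n *\<^sub>R (\<chi> k. Re (b k n))) sums f t" for t
    unfolding sums_def
  proof (rule vec_tendstoI)
    fix k
    have "(\<lambda>n. b k n * (of_real t - of_real t0)^n) sums (F (of_real t) $ k)"
      using assms unfolding b_def
      by (intro holomorphic_power_series[where r = "\<bar>t - t0\<bar> + 1"])
         (auto simp: holomorphic_extension_def dist_of_real dist_real_def intro: holomorphic_on_subset)
    from sums_Re[OF this]
    have "(\<lambda>n. Re (b k n * of_real ((t - t0)^n))) sums Re (F (of_real t) $ k)"
      by (simp only: of_real_diff of_real_power)
    then show "(\<lambda>n. (\<Sum>i<n. (t - t0)^i *\<^sub>R (\<chi> k. Re (b k i))) $ k) \<longlonglongrightarrow> f t $ k"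
      using assms by (simp add: sums_def holomorphic_extension_def mult.commute del: of_real_power)
  qed
  then show "\<exists>r>0. \<exists>c. \<forall>t. \<bar>t - t0\<bar> < r \<longrightarrow> (\<lambda>n. (t - t0)^n *\<^sub>R c n) sums f t"
    \<comment> \<open>The series converges for every \<open>t\<close>, so the radius 1 is
      arbitrary.\<close>
    by (intro exI[of _ 1] conjI exI[of _ "\<lambda>n. \<chi> k. Re (b k n)"]) auto
qed

text \<open>Identity theorem on the connected set \<open>D\<close>. The representation formula
  quantifies existentially over the extensions; this shows that they can be replaced by explicit
  ones.\<close>

lemma holomorphic_extension_unique:
  assumes "holomorphic_extension I D f F" "holomorphic_extension I D f G"
    and "open I" "I \<noteq> {}" "bjorling_domain I D" "z \<in> D"
  shows "F z = G z"
proof -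
  obtain t where t: "t \<in> I" using \<open>I \<noteq> {}\<close> by auto
  have D: "open D" "connected D" "complex_of_real ` I \<subseteq> D"
    using assms(5) by (auto simp: bjorling_domain_def simply_connected_imp_connected)
  \<comment> \<open>The zeros of the difference must accumulate in \<open>D\<close>; every point of
    the open set \<open>I\<close> is such an accumulation point.\<close>
  have lim: "complex_of_real t islimpt complex_of_real ` I"
    unfolding islimpt_approachable
  proof (intro allI impI)
    fix e :: real assume "e > 0"
    moreover have "t islimpt I"
      using t \<open>open I\<close> by (simp add: interior_open interior_limit_point)
    ultimately obtain s where "s \<in> I" "s \<noteq> t" "dist s t < e"
      unfolding islimpt_approachable by blast
    then show "\<exists>x'\<in>complex_of_real ` I. x' \<noteq> complex_of_real t \<and> dist x' (complex_of_real t) < e"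
      by (auto simp: dist_of_real)
  qed
  have "F z $ k - G z $ k = 0" for k
    by (rule analytic_continuation[OF _ D _ lim, where f = "\<lambda>z. F z $ k - G z $ k"])
       (use assms t D(3) in \<open>auto simp: holomorphic_extension_def intro!: holomorphic_intros\<close>)
  then show ?thesis by (simp add: vec_eq_iff)
qed

lemma cderiv_cong_open:
  assumes "open D" "z \<in> D" "\<And>w. w \<in> D \<Longrightarrow> F w = G w"
  shows "cderiv F z = cderiv G z"
proof -
  have "eventually (\<lambda>w. F w = G w) (nhds z)"
    using assms eventually_nhds by blast
  then show ?thesis
    by (auto simp: vec_eq_iff intro!: deriv_cong_ev elim: eventually_mono)
qed

section \<open>The representation formula through a primitive\<close>

lemma path_integral_primitive:
  assumes "\<And>z k. z \<in> D \<Longrightarrow> ((\<lambda>z. P z $ k) has_field_derivative F z $ k) (at z)"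
    and "valid_path \<gamma>" "path_image \<gamma> \<subseteq> D"
  shows "path_integral \<gamma> F = P (pathfinish \<gamma>) - P (pathstart \<gamma>)"
proof -
  have "contour_integral \<gamma> (\<lambda>w. F w $ k) = P (pathfinish \<gamma>) $ k - P (pathstart \<gamma>) $ k" for k
    using assms
    by (intro contour_integral_unique contour_integral_primitive[of D])
       (auto intro: has_field_derivative_at_within)
  then show ?thesis by (simp add: path_integral_def vec_eq_iff)
qed

text \<open>Uniqueness fixes the extensions, and a primitive turns each path integral into a
  difference of endpoint values. Quantifiers over extensions and paths thus disappear.\<close>

lemma bjorling_representation_iff_primitive:
  assumes dom: "bjorling_domain I D" and I: "open I" "u\<^sub>0 \<in> I"
    and A: "holomorphic_extension I D \<alpha> A" and W: "holomorphic_extension I D V W"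
    and P: "\<And>z k. z \<in> D \<Longrightarrow>
      ((\<lambda>z. P z $ k) has_field_derivative lorentz_cross (W z) (cderiv A z) $ k) (at z)"
  shows "bjorling_representation I \<alpha> V u\<^sub>0 D X \<longleftrightarrow>
    (\<forall>u v. Complex u v \<in> D \<longrightarrow>
       X u v = Re_vec (A (Complex u v) + \<i> *s (P (Complex u v) - P (of_real u\<^sub>0))))"
proof
  assume "bjorling_representation I \<alpha> V u\<^sub>0 D X"
  then obtain A' W' where A': "holomorphic_extension I D \<alpha> A'" and W': "holomorphic_extension I D V W'"
    and rep: "\<And>u v \<gamma>. Complex u v \<in> D \<Longrightarrow> valid_path \<gamma> \<Longrightarrow> path_image \<gamma> \<subseteq> D \<Longrightarrow>
      pathstart \<gamma> = of_real u\<^sub>0 \<Longrightarrow> pathfinish \<gamma> = Complex u v \<Longrightarrow>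
      X u v = Re_vec (A' (Complex u v) + \<i> *s path_integral \<gamma> (\<lambda>w. lorentz_cross (W' w) (cderiv A' w)))"
    unfolding bjorling_representation_def by blast
  have D: "open D" "connected D" "complex_of_real ` I \<subseteq> D"
    using dom by (auto simp: bjorling_domain_def simply_connected_imp_connected)
  have "I \<noteq> {}" using I by auto
  have eq: "A' w = A w" "W' w = W w" if "w \<in> D" for w
    using holomorphic_extension_unique[OF A' A I(1) \<open>I \<noteq> {}\<close> dom that]
      holomorphic_extension_unique[OF W' W I(1) \<open>I \<noteq> {}\<close> dom that] by auto
  show "\<forall>u v. Complex u v \<in> D \<longrightarrow>
       X u v = Re_vec (A (Complex u v) + \<i> *s (P (Complex u v) - P (of_real u\<^sub>0)))"
  proof (intro allI impI)
    fix u v assume z: "Complex u v \<in> D"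
    \<comment> \<open>The formula constrains \<open>X\<close> only through existing paths; an open
      connected set joins its points by polynomial paths, which are valid.\<close>
    obtain \<gamma> where \<gamma>: "polynomial_function \<gamma>" "path_image \<gamma> \<subseteq> D"
        "pathstart \<gamma> = of_real u\<^sub>0" "pathfinish \<gamma> = Complex u v"
      using connected_open_polynomial_connected[OF D(1,2) _ z, of "of_real u\<^sub>0"] D(3) I by auto
    note vp = valid_path_polynomial_function[OF \<gamma>(1)]
    \<comment> \<open>Agreement of the extensions on the open set \<open>D\<close> carries over to
      derivatives, so \<open>P\<close> is also a primitive of the integrand built from
      \<open>A'\<close> and \<open>W'\<close>.\<close>
    have "((\<lambda>z. P z $ k) has_field_derivative lorentz_cross (W' z) (cderiv A' z) $ k) (at z)"
      if "z \<in> D" for z k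
      using P[OF that] eq(2)[OF that] cderiv_cong_open[OF D(1) that eq(1)] by simp
    from path_integral_primitive[OF this vp \<gamma>(2)]
    show "X u v = Re_vec (A (Complex u v) + \<i> *s (P (Complex u v) - P (of_real u\<^sub>0)))"
      using rep[OF z vp \<gamma>(2-4)] \<gamma>(3,4) eq(1)[OF z] by simp
  qed
next
  assume "\<forall>u v. Complex u v \<in> D \<longrightarrow>
       X u v = Re_vec (A (Complex u v) + \<i> *s (P (Complex u v) - P (of_real u\<^sub>0)))"
  then show "bjorling_representation I \<alpha> V u\<^sub>0 D X"
    unfolding bjorling_representation_def
    using path_integral_primitive[OF P, of D] A W
    by (intro exI[of _ A] exI[of _ W]) auto
qed

section \<open>The complexified circle and its normal field\<close>

definition circ_ext :: "complex \<Rightarrow> complex^3" where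
  "circ_ext z = vector [0, sinh z, cosh z]"

definition circ_field_ext :: "real \<Rightarrow> complex \<Rightarrow> complex^3" where
  "circ_field_ext a z =
     vector [sinh (of_real a * z), cosh (of_real a * z) * sinh z, cosh (of_real a * z) * cosh z]"

text \<open>Integrating sinh(az) sinh z and sinh(az) cosh z by parts twice returns the same integral
  and produces the factor 1/(a^2 - 1). The case a = 1 is the resonance, where the linear term z/2
  appears.\<close>

definition circ_primitive :: "real \<Rightarrow> complex \<Rightarrow> complex^3" where
  "circ_primitive a z = vector
     [- sinh (of_real a * z) / of_real a,
      if a = 1 then (z - sinh z * cosh z) / 2
      else (sinh (of_real a * z) * cosh z - of_real a * cosh (of_real a * z) * sinh z) / of_real (a^2 - 1),
      if a = 1 then - (sinh z)\<^sup>2 / 2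
      else (sinh (of_real a * z) * sinh z - of_real a * cosh (of_real a * z) * cosh z) / of_real (a^2 - 1)]"

lemma of_real_times_Complex: "of_real a * Complex u v = Complex (a * u) (a * v)"
  by (simp add: complex_eq_iff)

text \<open>Addition theorems, together with sinh(iv) = i sin v and cosh(iv) = cos v.\<close>

lemma sinh_Complex: "sinh (Complex u v) = Complex (sinh u * cos v) (cosh u * sin v)"
  and cosh_Complex: "cosh (Complex u v) = Complex (cosh u * cos v) (sinh u * sin v)"
proof -
  have r: "sinh (complex_of_real x) = of_real (sinh x)" "cosh (complex_of_real x) = of_real (cosh x)" for x
    by (simp_all add: sinh_field_def cosh_field_def exp_of_real flip: of_real_minus)
  have i: "sinh (\<i> * of_real v) = \<i> * of_real (sin v)" "cosh (\<i> * of_real v) = of_real (cos v)"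
    by (simp_all add: sinh_conv_sin cosh_conv_cos sin_of_real cos_of_real flip: mult.assoc)
  show "sinh (Complex u v) = Complex (sinh u * cos v) (cosh u * sin v)"
       "cosh (Complex u v) = Complex (cosh u * cos v) (sinh u * sin v)"
    unfolding Complex_eq sinh_add cosh_add r i by (simp_all add: complex_eq_iff)
qed

lemma holomorphic_extension_circ: "holomorphic_extension UNIV D circ circ_ext"
  unfolding holomorphic_extension_def
proof (intro conjI ballI allI)
  show "(\<lambda>z. circ_ext z $ k) holomorphic_on D" for k
    using exhaust_3[of k] by (auto simp: circ_ext_def sinh_conv_sin cosh_conv_cos intro!: holomorphic_intros)
  show "circ_ext (of_real t) $ k = of_real (circ t $ k)" for t k
    \<comment> \<open>Imaginary part 0 reduces the complex functions to the real ones.\<close>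
    using exhaust_3[of k] sinh_Complex[of t 0] cosh_Complex[of t 0]
    by (auto simp: circ_ext_def circ_def simp flip: complex_of_real_def)
qed

lemma holomorphic_extension_circ_field:
  "holomorphic_extension UNIV D (circ_field a) (circ_field_ext a)"
  unfolding holomorphic_extension_def
proof (intro conjI ballI allI)
  show "(\<lambda>z. circ_field_ext a z $ k) holomorphic_on D" for k
    using exhaust_3[of k]
    by (auto simp: circ_field_ext_def sinh_conv_sin cosh_conv_cos intro!: holomorphic_intros)
  show "circ_field_ext a (of_real t) $ k = of_real (circ_field a t $ k)" for t k
    using exhaust_3[of k] sinh_Complex[of _ 0] cosh_Complex[of _ 0]
    by (auto simp: circ_field_ext_def circ_field_eq simp flip: complex_of_real_def of_real_mult)
qed

lemma cderiv_circ_ext: "cderiv circ_ext z = vector [0, cosh z, sinh z]"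
proof -
  have "deriv sinh z = cosh z" "deriv cosh z = sinh z"
    by (auto intro!: DERIV_imp_deriv derivative_eq_intros)
  then show ?thesis
    by (simp add: vec_eq_iff forall_3 circ_ext_def)
qed

lemma lorentz_cross_circ_ext:
  "lorentz_cross (circ_field_ext a z) (cderiv circ_ext z) =
     vector [- cosh (of_real a * z), - sinh (of_real a * z) * sinh z, - sinh (of_real a * z) * cosh z]"
proof -
  have "c * s * s - c * C * C = - c" if "C\<^sup>2 - s\<^sup>2 = 1" for c s C :: complex
    using that by algebra
  from this[OF hyperbolic_pythagoras] show ?thesis
    by (simp add: vec_eq_iff forall_3 lorentz_cross_def circ_field_ext_def cderiv_circ_ext)
qed

lemma circ_primitive_has_derivative:
  assumes "a > 0"
  shows "((\<lambda>z. circ_primitive a z $ k) has_field_derivative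
    lorentz_cross (circ_field_ext a z) (cderiv circ_ext z) $ k) (at z)"
proof -
  \<comment> \<open>Positivity of \<open>a\<close> excludes the other root a = -1.\<close>
  have "complex_of_real (a\<^sup>2 - 1) \<noteq> 0" if "a \<noteq> 1"
    using that assms by (simp only: of_real_eq_0_iff) (simp add: power2_eq_1_iff)
  then have nz: "(complex_of_real a)\<^sup>2 - 1 \<noteq> 0" if "a \<noteq> 1"
    using that by simp
  have pyth: "(cosh z)\<^sup>2 = (sinh z)\<^sup>2 + 1"
    by (rule cosh_square_eq)
  have 1: "((\<lambda>z. - sinh (of_real a * z) / of_real a) has_field_derivative - cosh (of_real a * z)) (at z)"
    using assms by (auto intro!: derivative_eq_intros)
  have 2: "((\<lambda>z. (z - sinh z * cosh z) / 2) has_field_derivative - (sinh z * sinh z)) (at z)"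
    using pyth by (auto simp: algebra_simps power2_eq_square intro!: derivative_eq_intros)
  have 3: "((\<lambda>z. - (sinh z)\<^sup>2 / 2) has_field_derivative - (sinh z * cosh z)) (at z)"
    by (auto intro!: derivative_eq_intros)
  have 4: "((\<lambda>z. (sinh (of_real a * z) * cosh z - of_real a * cosh (of_real a * z) * sinh z) /
      of_real (a\<^sup>2 - 1)) has_field_derivative - (sinh (of_real a * z) * sinh z)) (at z)" if "a \<noteq> 1"
    using nz[OF that]
    by (auto simp: divide_simps intro!: derivative_eq_intros) (auto simp: algebra_simps power2_eq_square)
  have 5: "((\<lambda>z. (sinh (of_real a * z) * sinh z - of_real a * cosh (of_real a * z) * cosh z) /
      of_real (a\<^sup>2 - 1)) has_field_derivative - (sinh (of_real a * z) * cosh z)) (at z)" if "a \<noteq> 1"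
    using nz[OF that]
    by (auto simp: divide_simps intro!: derivative_eq_intros) (auto simp: algebra_simps power2_eq_square)
  show ?thesis
    unfolding lorentz_cross_circ_ext circ_primitive_def
    using exhaust_3[of k] 1 2 3 4 5 by (cases "a = 1") auto
qed

lemma bjorling_data_circ: "bjorling_data UNIV circ (circ_field a)"
proof -
  have deriv: "((\<lambda>t. circ t $ k) has_real_derivative vector [0, cosh t, sinh t] $ k) (at t)" for t k
    using exhaust_3[of k] by (auto simp: circ_def intro!: derivative_eq_intros)
  have "vector_derivative circ (at t) = vector [0, cosh t, sinh t]" for t
    by (intro vector_derivative_at has_vector_derivative_vecI)
       (rule deriv)
  moreover have "real_analytic_on circ UNIV" "real_analytic_on (circ_field a) UNIV"
    using holomorphic_extension_circ holomorphic_extension_circ_field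
    by (blast intro: holomorphic_extension_imp_real_analytic)+
  moreover have "(sinh (a * t))\<^sup>2 + (cosh (a * t) * sinh t)\<^sup>2 - (cosh (a * t) * cosh t)\<^sup>2 = - 1" for t
    by (simp add: power_mult_distrib cosh_square_eq algebra_simps)
  ultimately show ?thesis
    by (auto simp: bjorling_data_def lorentz_inner_def circ_field_eq Let_def cosh_square_eq
        simp flip: power2_eq_square)
qed

section \<open>The circle's holomorphic curve and the Bjorling problem\<close>

text \<open>The value of the primitive at 0 is not subtracted: it is real, so after multiplication
  by \<open>\<i>\<close> it does not affect the real part.\<close>

definition circ_curve :: "real \<Rightarrow> complex \<Rightarrow> complex^3" where
  "circ_curve a z = circ_ext z + \<i> *s circ_primitive a z"

lemma circ_curve_has_derivative:
  assumes "a > 0"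
  shows "((\<lambda>z. circ_curve a z $ k) has_field_derivative
     vector [- \<i> * cosh (of_real a * z), cosh z - \<i> * sinh (of_real a * z) * sinh z,
       sinh z - \<i> * sinh (of_real a * z) * cosh z] $ k) (at z)"
proof -
  have "((\<lambda>z. circ_ext z $ k) has_field_derivative vector [0, cosh z, sinh z] $ k) (at z)"
    using exhaust_3[of k] by (auto simp: circ_ext_def intro!: derivative_eq_intros)
  from DERIV_add[OF this DERIV_cmult[OF circ_primitive_has_derivative[OF assms, of k], of \<i>]]
  show ?thesis
    using exhaust_3[of k]
    by (elim disjE) (simp_all add: circ_curve_def lorentz_cross_circ_ext mult.assoc)
qed

lemma cderiv_circ_curve:
  assumes "a > 0"
  shows "cderiv (circ_curve a) z =
     vector [- \<i> * cosh (of_real a * z), cosh z - \<i> * sinh (of_real a * z) * sinh z,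
       sinh z - \<i> * sinh (of_real a * z) * cosh z]"
  using DERIV_imp_deriv[OF circ_curve_has_derivative[OF assms]] by (simp add: vec_eq_iff)

lemma solves_bjorling_problem_circ:
  assumes "a > 0" and dom: "bjorling_domain UNIV D"
    and X: "\<And>u v. Complex u v \<in> D \<Longrightarrow> X u v = Re_vec (circ_curve a (Complex u v))"
  shows "solves_bjorling_problem UNIV circ (circ_field a) D X"
proof -
  have "open D" and real: "Complex u 0 \<in> D" for u
    using dom by (auto simp: bjorling_domain_def simp flip: complex_of_real_def)
  have hol: "(\<lambda>z. circ_curve a z $ k) holomorphic_on D" for k
    using circ_curve_has_derivative[OF \<open>a > 0\<close>] DERIV_subset
    by (fastforce simp: holomorphic_on_def field_differentiable_def)
  have "maximal_surface D X"
  proof (rule maximal_surface_Re_vec[OF \<open>open D\<close> hol X])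
    fix z
    \<comment> \<open>The mixed terms cancel, leaving -c^2 + (1 + s^2)(C^2 - S^2), which vanishes by
      the two hyperbolic identities.\<close>
    have "(- \<i> * c)\<^sup>2 + (C - \<i> * s * S)\<^sup>2 - (S - \<i> * s * C)\<^sup>2 = 0"
      if "c\<^sup>2 = s\<^sup>2 + 1" "C\<^sup>2 = S\<^sup>2 + 1" for c s C S :: complex
    proof -
      have "\<i>\<^sup>2 = -1" by simp
      with that show ?thesis by algebra
    qed
    from this[OF cosh_square_eq cosh_square_eq]
    show "(cderiv (circ_curve a) z $ 1)\<^sup>2 + (cderiv (circ_curve a) z $ 2)\<^sup>2
        - (cderiv (circ_curve a) z $ 3)\<^sup>2 = 0"
      by (simp add: cderiv_circ_curve[OF \<open>a > 0\<close>])
  qed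
  moreover have "regular_at X u 0 \<and> X u 0 = circ u \<and> unit_normal X u 0 = circ_field a u" for u
  proof -
    have pyth: "cosh x * cosh x = sinh x * sinh x + 1" for x :: real
      using cosh_square_eq[of x] by (simp add: power2_eq_square)
    have du: "du X u 0 = vector [0, cosh u, sinh u]"
      by (simp add: du_Re_vec[OF \<open>open D\<close> hol X real] cderiv_circ_curve[OF \<open>a > 0\<close>]
          vec_eq_iff forall_3 of_real_times_Complex sinh_Complex cosh_Complex
          del: cderiv_nth)
    have dv: "dv X u 0 = vector [cosh (a * u), sinh (a * u) * sinh u, sinh (a * u) * cosh u]"
      by (simp add: dv_Re_vec[OF \<open>open D\<close> hol X real] cderiv_circ_curve[OF \<open>a > 0\<close>]
          vec_eq_iff forall_3 of_real_times_Complex sinh_Complex cosh_Complex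
          del: cderiv_nth)
    \<comment> \<open>Here E = G = 1 and F = 0. The zeros are kept so that the equation matches the
      unfolded \<open>metric_det\<close> literally.\<close>
    have "(0 * 0 + C * C - S * S) * (c * c + s * S * (s * S) - s * C * (s * C)) -
        (0 * c + C * (s * S) - S * (s * C))\<^sup>2 = 1"
      if "C * C = S * S + 1" "c * c = s * s + 1" for c s C S :: real
    proof -
      have "(0 * 0 + C * C - S * S) * (c * c + s * S * (s * S) - s * C * (s * C)) -
          (0 * c + C * (s * S) - S * (s * C))\<^sup>2 = (C * C - S * S) * (c * c - s * s * (C * C - S * S))"
        by (simp add: algebra_simps)
      with that show ?thesis by simp
    qed
    from this[OF pyth pyth] have "metric_det X u 0 = 1"
      unfolding metric_det_def fundE_def fundF_def fundG_def lorentz_inner_def du dv vector_3 .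
    \<comment> \<open>The cross product is already the unit field, so the normalizing factor in
      \<open>unit_normal\<close> is 1 and the sign comes out right.\<close>
    moreover have cross: "lorentz_cross (du X u 0) (dv X u 0) = circ_field a u"
      unfolding du dv circ_field_eq using arg_cong[OF pyth[of u], of "(*) (sinh (a * u))"]
      by (simp add: vec_eq_iff forall_3 lorentz_cross_def algebra_simps)
    moreover have "lorentz_inner (circ_field a u) (circ_field a u) = -1"
      using bjorling_data_circ[of a] by (simp add: bjorling_data_def Let_def)
    moreover have "X u 0 = circ u"
      unfolding X[OF real]
      by (simp add: vec_eq_iff forall_3 of_real_times_Complex sinh_Complex cosh_Complex circ_curve_def circ_ext_def
          circ_primitive_def circ_def power2_eq_square)
    ultimately show ?thesis
      by (simp add: regular_at_def unit_normal_def Let_def)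
  qed
  ultimately show ?thesis
    by (simp add: solves_bjorling_problem_def)
qed

text \<open>The representation formula alone determines \<open>X\<close> on \<open>D\<close>;
  conversely, that \<open>X\<close> also solves the Bjorling problem, so both requirements of
  \<open>bjorling_surface\<close> hold.\<close>

lemma bjorling_surface_circ_iff:
  assumes "a > 0" and dom: "bjorling_domain UNIV D"
  shows "bjorling_surface UNIV circ (circ_field a) 0 D X \<longleftrightarrow>
    (\<forall>u v. Complex u v \<in> D \<longrightarrow> X u v = Re_vec (circ_curve a (Complex u v)))"
proof -
  have "Re_vec (circ_ext z + \<i> *s (circ_primitive a z - circ_primitive a (of_real 0))) =
      Re_vec (circ_curve a z)" for z
    by (simp add: vec_eq_iff forall_3 circ_curve_def circ_primitive_def)
  then have "bjorling_representation UNIV circ (circ_field a) 0 D X \<longleftrightarrow>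
    (\<forall>u v. Complex u v \<in> D \<longrightarrow> X u v = Re_vec (circ_curve a (Complex u v)))"
    using bjorling_representation_iff_primitive[OF dom open_UNIV UNIV_I holomorphic_extension_circ
        holomorphic_extension_circ_field circ_primitive_has_derivative[OF \<open>a > 0\<close>], of 0 X]
    by simp
  then show ?thesis
    using solves_bjorling_problem_circ[OF assms] bjorling_data_circ dom
    by (auto simp: bjorling_surface_def)
qed

section \<open>Explicit coordinates\<close>

lemma circ_curve_nth:
  assumes "a > 0" "a \<noteq> 1"
  shows "Re (circ_curve a (Complex u v) $ 1) = cosh (a * u) * sin (a * v) / a"
    and "Re (circ_curve a (Complex u v) $ 2) = sinh u * cos v + 1 / (a^2 - 1) *
          (- sin v * cos (a * v) * sinh u * sinh (a * u) + a * sin (a * v) * cos v * sinh u * sinh (a * u)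
           + a * sin v * cos (a * v) * cosh u * cosh (a * u) - cos v * sin (a * v) * cosh u * cosh (a * u))"
    and "Re (circ_curve a (Complex u v) $ 3) = cosh u * cos v + 1 / (a^2 - 1) *
          (a * cos v * sin (a * v) * cosh u * sinh (a * u) - sin v * cos (a * v) * cosh u * sinh (a * u)
           + a * sin v * cos (a * v) * sinh u * cosh (a * u) - cos v * sin (a * v) * sinh u * cosh (a * u))"
  using assms
  by (simp_all add: circ_curve_def circ_ext_def circ_primitive_def of_real_times_Complex sinh_Complex
      cosh_Complex algebra_simps add_divide_distrib diff_divide_distrib del: of_real_diff)

lemma circ_curve_nth_1:
  shows "Re (circ_curve 1 (Complex u v) $ 1) = cosh u * sin v"
    and "Re (circ_curve 1 (Complex u v) $ 2) = sinh u * cos v + 1/2 * sin v * cos v * ((sinh u)^2 + (cosh u)^2) - v / 2"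
    and "Re (circ_curve 1 (Complex u v) $ 3) = cosh u * cos v * (1 + sinh u * sin v)"
  by (simp_all add: circ_curve_def circ_ext_def circ_primitive_def sinh_Complex cosh_Complex
      power2_eq_square algebra_simps add_divide_distrib diff_divide_distrib)

text \<open>The equivalence gives both that the formulas hold for every Bjorling surface with these
  data and that a map given by them on \<open>D\<close> is one.\<close>

theorem mainTheorem2:
  fixes a :: real and D :: "complex set" and X :: "real \<Rightarrow> real \<Rightarrow> real^3"
  assumes "a > 0" and "bjorling_domain UNIV D"
  shows "bjorling_surface UNIV circ (circ_field a) 0 D X \<longleftrightarrow>
    (\<forall>u v. Complex u v \<in> D \<longrightarrow>
      (a \<noteq> 1 \<longrightarrow>
        X u v $ 1 = cosh (a * u) * sin (a * v) / a \<and>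
        X u v $ 2 = sinh u * cos v + 1 / (a^2 - 1) *
          (- sin v * cos (a * v) * sinh u * sinh (a * u) + a * sin (a * v) * cos v * sinh u * sinh (a * u)
           + a * sin v * cos (a * v) * cosh u * cosh (a * u) - cos v * sin (a * v) * cosh u * cosh (a * u)) \<and>
        X u v $ 3 = cosh u * cos v + 1 / (a^2 - 1) *
          (a * cos v * sin (a * v) * cosh u * sinh (a * u) - sin v * cos (a * v) * cosh u * sinh (a * u)
           + a * sin v * cos (a * v) * sinh u * cosh (a * u) - cos v * sin (a * v) * sinh u * cosh (a * u))) \<and>
      (a = 1 \<longrightarrow>
        X u v $ 1 = cosh u * sin v \<and>
        X u v $ 2 = sinh u * cos v + 1/2 * sin v * cos v * ((sinh u)^2 + (cosh u)^2) - v / 2 \<and>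
        X u v $ 3 = cosh u * cos v * (1 + sinh u * sin v)))"
  unfolding bjorling_surface_circ_iff[OF assms]
  by (cases "a = 1")
     (simp_all add: vec_eq_iff[of "X _ _"] forall_3 circ_curve_nth_1 circ_curve_nth[OF assms(1)])

end
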